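(* Let $Y$ be any non-negative integer-valued random variable, let $n\ge1$ be an integer, let $U=n[\frac{Y}{n}]$ and $\omega=\exp(\frac{2\pi i}{n})$. Let $$r=\begin{cases}1,& n\text{ even}\\ 1/2,& n\text{ odd}\end{cases}\qquad\text{and}\qquad a(j)=\begin{cases}(-1)^j,& n\text{ even}\\ (-1)^j\omega^{j/2},& n\text{ odd.}\end{cases}$$ Then $$\operatorname{E}(U)=\operatorname{E}(Y)+\frac12(2r-1)+\sum_{j=1}^{n-1}a(j)\frac{G_Y(\frac{1}{\omega^j})}{1-\omega^j}$$ and $$\operatorname{Var}(U)=\operatorname{Var}(Y)+\frac{1}{12}(n^2-1)-\bigl(2\operatorname{E}(Y)-1\bigr)\sum_{j=1}^{n-1}a(j)\frac{G_Y(\frac1{\omega^j})}{1-\omega^j}-\left(\sum_{j=1}^{n-1}a(j)\frac{G_Y(\frac1{\omega^j})}{1-\omega^j}\right)^2+2\sum_{j=1}^{n-1}a(j)\left(\frac{G_Y'(\frac1{\omega^j})}{\omega^j(1-\omega^j)}-\frac{G_Y(\frac1{\omega^j})}{(1-\omega^j)^2}\right).$$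
   Context: For real $x$, $[x]$ denotes $x$ rounded to the nearest integer with the round-half-up tie-breaking rule, i.e. $[x]=\lfloor x+\tfrac12\rfloor$. $G_Y(s)=\operatorname{E}(s^Y)=\sum_{y=0}^\infty P(Y=y)s^y$ is the probability generating function of $Y$ and $G_Y'(s)=\sum_{y\ge1}yP(Y=y)s^{y-1}$ its derivative, both evaluated at complex points of the closed unit disc. Here $\omega^{j/2}$ means $\exp(\pi i j/n)$. The identities are understood for $Y$ whose moments occurring in them are finite ($\operatorname{E}(Y)<\infty$ for the first, $\operatorname{E}(Y^2)<\infty$ for the second). Empty sums (case $n=1$) are $0$. *)

theory Defs
  imports "HOL-Probability.Probability"
begin

definition root_unity :: "nat \<Rightarrow> complex" where
  "root_unity n = exp (2 * of_real pi * \<i> / of_nat n)"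

definition half_root_power :: "nat \<Rightarrow> nat \<Rightarrow> complex" where
  "half_root_power n j = exp (of_real pi * \<i> * of_nat j / of_nat n)"

definition r_const :: "nat \<Rightarrow> real" where
  "r_const n = (if even n then 1 else 1 / 2)"

definition a_coeff :: "nat \<Rightarrow> nat \<Rightarrow> complex" where
  "a_coeff n j = (if even n then (- 1) ^ j else (- 1) ^ j * half_root_power n j)"

text \<open>\<^const>\<open>round\<close> is \<open>\<lambda>x. \<lfloor>x + 1/2\<rfloor>\<close>, so ties are rounded up.\<close>

definition round_to_multiple :: "nat \<Rightarrow> nat \<Rightarrow> real" where
  "round_to_multiple n y = real n * of_int (round (real y / real n))"

definition pgf :: "'a measure \<Rightarrow> ('a \<Rightarrow> nat) \<Rightarrow> complex \<Rightarrow> complex" where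
  "pgf M Y s = (\<Sum>y. of_real (measure M {x \<in> space M. Y x = y}) * s ^ y)"

text \<open>The derivative is the term-by-term differentiated series (index shifted by one), because
  it is evaluated on the unit circle, where \<^const>\<open>pgf\<close> need not be differentiable in a
  neighbourhood.\<close>

definition pgf_deriv :: "'a measure \<Rightarrow> ('a \<Rightarrow> nat) \<Rightarrow> complex \<Rightarrow> complex" where
  "pgf_deriv M Y s =
     (\<Sum>y. of_nat (Suc y) * of_real (measure M {x \<in> space M. Y x = Suc y}) * s ^ y)"

lemma half_root_power_square: "(half_root_power n j)\<^sup>2 = root_unity n ^ j"
  unfolding half_root_power_def root_unity_def
  by (simp add: exp_of_nat_mult [symmetric] exp_double [symmetric] algebra_simps)

lemma (in prob_space) sums_expectation_nat_valued:
  fixes f :: "nat \<Rightarrow> complex"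
  assumes Y: "Y \<in> measurable M (count_space UNIV)"
    and f: "integrable M (\<lambda>x. f (Y x))"
  shows "summable (\<lambda>y. norm (of_real (prob {x \<in> space M. Y x = y}) * f y))"
    and "(\<lambda>y. of_real (prob {x \<in> space M. Y x = y}) * f y) sums expectation (\<lambda>x. f (Y x))"
proof -
  let ?p = "\<lambda>y. prob {x \<in> space M. Y x = y}"
  have eq: "distr M (count_space UNIV) Y = density (count_space UNIV) (\<lambda>y. ennreal (?p y))"
  proof (rule measure_eqI_countable[where A = UNIV])
    fix y :: nat
    have "Y -` {y} \<inter> space M = {x \<in> space M. Y x = y}" by auto
    then show "emeasure (distr M (count_space UNIV) Y) {y}
        = emeasure (density (count_space UNIV) (\<lambda>y. ennreal (?p y))) {y}"
      using Y by (simp add: emeasure_distr emeasure_density emeasure_eq_measure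
          nn_integral_count_space_indicator [symmetric] nn_integral_count_space_finite)
  qed auto
  have "integrable (distr M (count_space UNIV) Y) f"
    using f Y by (subst integrable_distr_eq) auto
  then have int: "integrable (count_space UNIV) (\<lambda>y. ?p y *\<^sub>R f y)"
    unfolding eq by (subst (asm) integrable_density) auto
  have "expectation (\<lambda>x. f (Y x)) = integral\<^sup>L (distr M (count_space UNIV) Y) f"
    using Y by (subst integral_distr) auto
  also have "\<dots> = integral\<^sup>L (count_space UNIV) (\<lambda>y. ?p y *\<^sub>R f y)"
    unfolding eq by (subst integral_density) auto
  finally show "(\<lambda>y. of_real (?p y) * f y) sums expectation (\<lambda>x. f (Y x))"
    using sums_integral_count_space_nat[OF int] by (simp add: scaleR_conv_of_real)
  show "summable (\<lambda>y. norm (of_real (?p y) * f y))"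
    using int by (simp add: integrable_count_space_nat_iff norm_mult)
qed

lemma (in prob_space) integrable_power_nat_valued:
  fixes s :: complex
  assumes "Y \<in> measurable M (count_space UNIV)" "norm s \<le> 1"
  shows "integrable M (\<lambda>x. s ^ Y x)"
proof (rule integrable_const_bound[where B = 1])
  show "AE x in M. norm (s ^ Y x) \<le> 1"
    using assms(2) by (simp add: norm_power power_le_one)
  show "(\<lambda>x. s ^ Y x) \<in> borel_measurable M"
    using measurable_compose[OF assms(1), of "\<lambda>y. s ^ y"] by simp
qed

lemma (in prob_space) pgf_eq_expectation:
  assumes "Y \<in> measurable M (count_space UNIV)" "norm s \<le> 1"
  shows "pgf M Y s = expectation (\<lambda>x. s ^ Y x)"
  unfolding pgf_def
  using sums_expectation_nat_valued(2)[OF assms(1), of "\<lambda>y. s ^ y"]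
    integrable_power_nat_valued[OF assms] by (simp add: sums_iff)

lemma (in prob_space) summable_pgf_deriv:
  assumes Y: "Y \<in> measurable M (count_space UNIV)"
    and int: "integrable M (\<lambda>x. real (Y x))" and s: "norm s \<le> 1"
  shows "summable (\<lambda>y. of_nat (Suc y) * of_real (prob {x \<in> space M. Y x = Suc y}) * s ^ y :: complex)"
proof -
  have "integrable M (\<lambda>x. of_nat (Y x) :: complex)"
    using integrable_of_real[OF int, where 'a = complex] by simp
  from sums_expectation_nat_valued(1)[OF Y this]
  have "summable (\<lambda>y. prob {x \<in> space M. Y x = y} * real y)"
    by (simp add: norm_mult)
  then have "summable (\<lambda>y. prob {x \<in> space M. Y x = Suc y} * real (Suc y))"
    by (subst summable_Suc_iff)
  then show ?thesis
  proof (rule summable_comparison_test[rotated], intro exI allI impI)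
    fix y
    have "norm s ^ y \<le> 1" using s by (simp add: power_le_one)
    then show "norm (of_nat (Suc y) * of_real (prob {x \<in> space M. Y x = Suc y}) * s ^ y)
        \<le> prob {x \<in> space M. Y x = Suc y} * real (Suc y)"
      by (simp add: norm_mult norm_power mult_left_le mult_left_le_one_le mult.commute
          del: of_nat_Suc)
  qed
qed

lemma (in prob_space) has_field_derivative_pgf:
  assumes Y: "Y \<in> measurable M (count_space UNIV)" and s: "norm s < 1"
  shows "(pgf M Y has_field_derivative pgf_deriv M Y s) (at s)"
proof -
  let ?c = "\<lambda>y. of_real (prob {x \<in> space M. Y x = y}) :: complex"
  have "summable (\<lambda>y. ?c y * 1 ^ y)"
    using sums_expectation_nat_valued(2)[OF Y, of "\<lambda>_. 1"] by (simp add: sums_iff)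
  then have "((\<lambda>s. \<Sum>y. ?c y * s ^ y) has_field_derivative (\<Sum>y. diffs ?c y * s ^ y)) (at s)"
    using s by (intro termdiffs_strong[where K = 1]) auto
  then show ?thesis
    unfolding pgf_def[abs_def] pgf_deriv_def by (simp add: diffs_def)
qed

lemma abs_round_to_multiple_diff:
  assumes "n \<ge> 1"
  shows "\<bar>round_to_multiple n y - real y\<bar> \<le> real n / 2"
proof -
  have "round_to_multiple n y - real y
      = real n * (of_int (round (real y / real n)) - real y / real n)"
    using assms by (simp add: round_to_multiple_def right_diff_distrib)
  also have "\<bar>\<dots>\<bar> \<le> real n * (1 / 2)"
    unfolding abs_mult by (intro mult_mono of_int_round_abs_le) auto
  finally show ?thesis by simp
qed

lemma (in prob_space) integrable_round_to_multiple:
  assumes Y: "Y \<in> measurable M (count_space UNIV)" and n: "n \<ge> 1"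
  shows "integrable M (\<lambda>x. real (Y x)) \<Longrightarrow> integrable M (\<lambda>x. round_to_multiple n (Y x))"
    and "integrable M (\<lambda>x. (real (Y x))\<^sup>2) \<Longrightarrow> integrable M (\<lambda>x. (round_to_multiple n (Y x))\<^sup>2)"
proof -
  have meas [measurable]: "(\<lambda>x. g (Y x)) \<in> borel_measurable M" for g :: "nat \<Rightarrow> real"
    using measurable_compose[OF Y, of g] by simp
  note bound = abs_round_to_multiple_diff[OF n]
  show "integrable M (\<lambda>x. round_to_multiple n (Y x))" if "integrable M (\<lambda>x. real (Y x))"
  proof (rule Bochner_Integration.integrable_bound)
    show "integrable M (\<lambda>x. real (Y x) + real n / 2)" using that by simp
    show "AE x in M. norm (round_to_multiple n (Y x)) \<le> norm (real (Y x) + real n / 2)"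
    proof (rule AE_I2)
      fix x show "norm (round_to_multiple n (Y x)) \<le> norm (real (Y x) + real n / 2)"
        using bound[of "Y x"] unfolding real_norm_def by linarith
    qed
  qed (rule meas)
  show "integrable M (\<lambda>x. (round_to_multiple n (Y x))\<^sup>2)" if "integrable M (\<lambda>x. (real (Y x))\<^sup>2)"
  proof (rule Bochner_Integration.integrable_bound)
    show "integrable M (\<lambda>x. 2 * (real (Y x))\<^sup>2 + 2 * (real n / 2)\<^sup>2)" using that by simp
    show "AE x in M. norm ((round_to_multiple n (Y x))\<^sup>2)
        \<le> norm (2 * (real (Y x))\<^sup>2 + 2 * (real n / 2)\<^sup>2)"
    proof (rule AE_I2)
      fix x
      let ?u = "round_to_multiple n (Y x)" and ?y = "real (Y x)" and ?h = "real n / 2"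
      have "\<bar>?u\<bar> \<le> ?y + ?h" using bound[of "Y x"] by linarith
      then have "?u\<^sup>2 \<le> (?y + ?h)\<^sup>2"
        using power_mono[of "\<bar>?u\<bar>" "?y + ?h" 2] by simp
      also have "\<dots> \<le> 2 * ?y\<^sup>2 + 2 * ?h\<^sup>2"
        using zero_le_power2[of "?y - ?h"] by (simp add: power2_eq_square algebra_simps)
      finally show "norm (?u\<^sup>2) \<le> norm (2 * ?y\<^sup>2 + 2 * ?h\<^sup>2)" by simp
    qed
  qed (rule meas[of "\<lambda>y. (round_to_multiple n y)\<^sup>2"])
qed

end

theory Submission
  imports Defs
begin

text \<open>
  Rounding to a multiple of \<open>n\<close> changes an integer \<open>y\<close> by an amount that depends on \<open>y\<close> modulo
  \<open>n\<close> only. Put \<open>h = n div 2\<close>. Then \<open>U = y + h - m\<close> with \<open>m = (y + h) mod n\<close>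
  (lemma \<open>round_to_multiple_eq\<close>), so that \<open>U = y + c + e\<close>, where \<open>c = h - (n - 1) / 2\<close> is the
  constant \<open>(2 r - 1) / 2\<close> and the sawtooth \<open>e = (n - 1) / 2 - m\<close> has mean zero over a period.

  The sawtooth has a finite Fourier expansion: its coefficient at the character
  \<open>m \<mapsto> \<omega>\<^sup>-\<^sup>j\<^sup>m\<close> is \<open>1 / (1 - \<omega>\<^sup>j)\<close> (lemma \<open>sum_root_unity_linear\<close>). The phase \<open>\<omega>\<^sup>-\<^sup>j\<^sup>h\<close> that comes from
  the shift by \<open>h\<close> is exactly \<open>a(j)\<close>. Taking expectations turns each character into a value
  of the generating function, and the formula for the mean follows.

  For the variance, expand \<open>U\<^sup>2 = (y + c + e)\<^sup>2\<close>. The cross term \<open>y e\<close> has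
  expectation given by the derivative of the generating function. The square \<open>e\<^sup>2\<close> is again periodic,
  and the quadratic polynomial \<open>(e - e\<^sup>2 + (n\<^sup>2 - 1) / 12) / 2\<close> in \<open>m\<close> is the function with Fourier
  coefficients \<open>1 / (1 - \<omega>\<^sup>j)\<^sup>2\<close> (lemma \<open>sum_root_unity_quadratic\<close>). This removes \<open>e\<^sup>2\<close> in
  favour of a further linear combination of values of the generating function.
\<close>

section \<open>Sums over roots of unity\<close>

lemma root_unity_nonzero [simp]: "root_unity n \<noteq> 0"
  by (simp add: root_unity_def)

lemma root_unity_power_eq_1_iff:
  assumes "n \<ge> 1"
  shows "root_unity n ^ k = 1 \<longleftrightarrow> n dvd k"
  using complex_root_unity_eq_1[OF assms, of k]
  by (simp add: root_unity_def exp_of_nat_mult [symmetric] algebra_simps)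

lemma norm_inverse_root_unity_power: "norm (1 / root_unity n ^ j) = 1"
proof -
  have "norm (root_unity n) = 1"
    by (simp add: root_unity_def)
  then show ?thesis
    by (simp add: norm_divide norm_power)
qed

lemma inverse_root_unity_power_neq_1:
  assumes "0 < k" "k < n"
  shows "1 / root_unity n ^ k \<noteq> 1"
  using root_unity_power_eq_1_iff[of n k] assms by (auto simp: dvd_imp_le nat_dvd_not_less)

lemma inverse_root_unity_power_full [simp]:
  assumes "n \<ge> 1"
  shows "(1 / root_unity n ^ k) ^ n = 1"
  using root_unity_power_eq_1_iff[OF assms, of "k * n"]
  by (simp add: power_divide power_mult [symmetric])

lemma inverse_root_unity_power_mod:
  assumes "n \<ge> 1"
  shows "(1 / root_unity n ^ j) ^ (k mod n) = (1 / root_unity n ^ j) ^ k"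
proof -
  have "(1 / root_unity n ^ j) ^ k = (1 / root_unity n ^ j) ^ (n * (k div n) + k mod n)"
    by simp
  also have "\<dots> = ((1 / root_unity n ^ j) ^ n) ^ (k div n) * (1 / root_unity n ^ j) ^ (k mod n)"
    by (simp only: power_add power_mult)
  finally show ?thesis
    using assms by simp
qed

lemma sum_root_unity_full:
  assumes "0 < k" "k < n"
  shows "(\<Sum>m<n. (1 / root_unity n ^ k) ^ m) = 0"
  using inverse_root_unity_power_neq_1[OF assms] inverse_root_unity_power_full[of n k] assms
  by (simp add: geometric_sum)

lemma sum_root_unity_punctured:
  assumes "0 < k" "k < n"
  shows "(\<Sum>j = 1..n - 1. (1 / root_unity n ^ j) ^ k) = - 1"
proof -
  have "{..<n} = insert 0 {1..n - 1}"
    using assms by auto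
  then have "0 = 1 + (\<Sum>j = 1..n - 1. (1 / root_unity n ^ k) ^ j)"
    using sum_root_unity_full[OF assms] by simp
  also have "(\<Sum>j = 1..n - 1. (1 / root_unity n ^ k) ^ j)
      = (\<Sum>j = 1..n - 1. (1 / root_unity n ^ j) ^ k)"
    by (simp add: power_divide power_mult [symmetric] mult.commute)
  finally show ?thesis
    by (simp add: eq_neg_iff_add_eq_0 add.commute)
qed

text \<open>
  A combination of the nontrivial characters has mean zero over a period. Since a function is
  determined by its increments up to a constant, this fixes the constant of integration in the
  two closed forms below without evaluating any sum of the type \<open>\<Sum>j. 1 / (1 - \<omega>\<^sup>j)\<close> directly.
\<close>

lemma sum_combination_root_unity_eq_0:
  "(\<Sum>m<n. \<Sum>j = 1..n - 1. c j * (1 / root_unity n ^ j) ^ m) = 0"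
proof -
  have "(\<Sum>m<n. \<Sum>j = 1..n - 1. c j * (1 / root_unity n ^ j) ^ m)
      = (\<Sum>j = 1..n - 1. c j * (\<Sum>m<n. (1 / root_unity n ^ j) ^ m))"
    by (subst sum.swap) (simp add: sum_distrib_left)
  also have "\<dots> = 0"
    by (rule sum.neutral) (auto simp: sum_root_unity_full)
  finally show ?thesis .
qed

lemma eq_if_increments_eq_and_sum_eq:
  fixes f g :: "nat \<Rightarrow> 'a :: field_char_0"
  assumes incr: "\<And>m. Suc m < n \<Longrightarrow> f (Suc m) - f m = g (Suc m) - g m"
    and sum: "(\<Sum>m<n. f m) = (\<Sum>m<n. g m)" and m: "m < n"
  shows "f m = g m"
proof -
  have shift: "f k = g k + (f 0 - g 0)" if "k < n" for k
    using that
  proof (induction k)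
    case (Suc k)
    have "f (Suc k) = f k + (g (Suc k) - g k)"
      using incr[OF Suc.prems] by (metis diff_add_cancel add.commute)
    then show ?case
      using Suc by simp
  qed simp
  have "(\<Sum>m<n. f m) = (\<Sum>m<n. g m + (f 0 - g 0))"
    by (rule sum.cong[OF refl]) (rule shift, simp)
  also have "\<dots> = (\<Sum>m<n. g m) + of_nat n * (f 0 - g 0)"
    by (simp add: sum.distrib)
  finally have "f 0 = g 0"
    using sum m by simp
  then show ?thesis
    using shift[OF m] by simp
qed

lemma root_unity_difference_quotient:
  assumes "j \<in> {1..n - 1}"
  shows "c / (1 - root_unity n ^ j) * (1 / root_unity n ^ j) ^ Suc m
      - c / (1 - root_unity n ^ j) * (1 / root_unity n ^ j) ^ m
    = c * (1 / root_unity n ^ j) ^ Suc m"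
proof -
  have "0 < j" "j < n"
    using assms by auto
  then have "root_unity n ^ j \<noteq> 1"
    using root_unity_power_eq_1_iff[of n j] by (auto dest: dvd_imp_le)
  moreover have "(1 / root_unity n ^ j) ^ m = root_unity n ^ j * (1 / root_unity n ^ j) ^ Suc m"
    by simp
  then have "(1 / root_unity n ^ j) ^ Suc m - (1 / root_unity n ^ j) ^ m
      = (1 - root_unity n ^ j) * (1 / root_unity n ^ j) ^ Suc m"
    by (simp only: left_diff_distrib mult_1)
  ultimately show ?thesis
    unfolding right_diff_distrib [symmetric] by simp
qed

text \<open>
  Passing from \<open>m\<close> to \<open>m + 1\<close> cancels the denominators, leaving the sum of the nontrivial
  characters at \<open>m + 1\<close>, which is \<open>- 1\<close>. So the left-hand side falls with slope one.
\<close>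

lemma sum_root_unity_linear:
  assumes "m < n"
  shows "(\<Sum>j = 1..n - 1. 1 / (1 - root_unity n ^ j) * (1 / root_unity n ^ j) ^ m)
    = (of_nat n - 1) / 2 - of_nat m"
proof (rule eq_if_increments_eq_and_sum_eq[OF _ _ assms])
  fix m assume "Suc m < n"
  then show "(\<Sum>j = 1..n - 1. 1 / (1 - root_unity n ^ j) * (1 / root_unity n ^ j) ^ Suc m)
      - (\<Sum>j = 1..n - 1. 1 / (1 - root_unity n ^ j) * (1 / root_unity n ^ j) ^ m)
    = (of_nat n - 1) / 2 - of_nat (Suc m) - ((of_nat n - 1) / 2 - of_nat m)"
    unfolding sum_subtractf [symmetric]
    using sum_root_unity_punctured[of "Suc m" n]
    by (simp only: root_unity_difference_quotient cong: sum.cong) simp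
next
  have "(\<Sum>m<k. (of_nat n - 1) / 2 - of_nat m :: complex) = of_nat k * (of_nat n - of_nat k) / 2"
    for k
  proof (induction k)
    case (Suc k)
    show ?case
      unfolding sum.lessThan_Suc Suc.IH by (simp add: field_simps)
  qed simp
  then show "(\<Sum>m<n. \<Sum>j = 1..n - 1. 1 / (1 - root_unity n ^ j) * (1 / root_unity n ^ j) ^ m)
      = (\<Sum>m<n. (of_nat n - 1) / 2 - of_nat m)"
    by (simp only: sum_combination_root_unity_eq_0) simp
qed

text \<open>
  The same difference argument one order higher: the increment is now the linear function of
  the preceding lemma, and the constant \<open>(n\<^sup>2 - 1) / 12\<close>, the variance of the uniform
  distribution on \<open>n\<close> consecutive integers, makes the mean over a period vanish.
\<close>

lemma sum_root_unity_quadratic: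
  fixes e :: "nat \<Rightarrow> nat \<Rightarrow> complex"
  defines "e \<equiv> \<lambda>n m. (of_nat n - 1) / 2 - of_nat m"
  assumes "m < n"
  shows "(\<Sum>j = 1..n - 1. 1 / (1 - root_unity n ^ j)\<^sup>2 * (1 / root_unity n ^ j) ^ m)
    = (e n m - (e n m)\<^sup>2 + ((of_nat n)\<^sup>2 - 1) / 12) / 2"
proof (rule eq_if_increments_eq_and_sum_eq[OF _ _ assms(2)])
  fix m assume m: "Suc m < n"
  have "(\<Sum>j = 1..n - 1. 1 / (1 - root_unity n ^ j)\<^sup>2 * (1 / root_unity n ^ j) ^ Suc m)
      - (\<Sum>j = 1..n - 1. 1 / (1 - root_unity n ^ j)\<^sup>2 * (1 / root_unity n ^ j) ^ m)
    = (\<Sum>j = 1..n - 1. 1 / (1 - root_unity n ^ j) * (1 / root_unity n ^ j) ^ Suc m)"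
    unfolding sum_subtractf [symmetric]
  proof (rule sum.cong[OF refl])
    fix j assume "j \<in> {1..n - 1}"
    from root_unity_difference_quotient[OF this, of "1 / (1 - root_unity n ^ j)" m]
    show "1 / (1 - root_unity n ^ j)\<^sup>2 * (1 / root_unity n ^ j) ^ Suc m
        - 1 / (1 - root_unity n ^ j)\<^sup>2 * (1 / root_unity n ^ j) ^ m
      = 1 / (1 - root_unity n ^ j) * (1 / root_unity n ^ j) ^ Suc m"
      by (simp only: divide_divide_eq_left power2_eq_square)
  qed
  also have "\<dots> = e n (Suc m)"
    unfolding e_def by (rule sum_root_unity_linear[OF m])
  also have "\<dots> = (e n (Suc m) - (e n (Suc m))\<^sup>2 + ((of_nat n)\<^sup>2 - 1) / 12) / 2
      - (e n m - (e n m)\<^sup>2 + ((of_nat n)\<^sup>2 - 1) / 12) / 2"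
  proof -
    have "e n (Suc m) = e n m - 1"
      by (simp add: e_def)
    then show ?thesis
      by (simp only: power2_diff) (simp add: field_simps)
  qed
  finally show "(\<Sum>j = 1..n - 1. 1 / (1 - root_unity n ^ j)\<^sup>2 * (1 / root_unity n ^ j) ^ Suc m)
      - (\<Sum>j = 1..n - 1. 1 / (1 - root_unity n ^ j)\<^sup>2 * (1 / root_unity n ^ j) ^ m)
    = (e n (Suc m) - (e n (Suc m))\<^sup>2 + ((of_nat n)\<^sup>2 - 1) / 12) / 2
      - (e n m - (e n m)\<^sup>2 + ((of_nat n)\<^sup>2 - 1) / 12) / 2" .
next
  \<comment> \<open>A closed form for every partial sum; the factor \<open>n - k\<close> is what vanishes at \<open>k = n\<close>.\<close>
  have "24 * (\<Sum>m<k. (e n m - (e n m)\<^sup>2 + ((of_nat n)\<^sup>2 - 1) / 12) / 2)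
      = 2 * of_nat k * (of_nat n - of_nat k) * (2 * of_nat k - of_nat n + 3)" for k
  proof (induction k)
    case (Suc k)
    \<comment> \<open>Denominators are cleared first, and \<open>n\<close> is eliminated in favour of \<open>e\<close> and \<open>k\<close>, so that
      only a polynomial identity remains.\<close>
    have clear: "24 * ((x - x\<^sup>2 + (a\<^sup>2 - 1) / 12) / 2) = 12 * x - 12 * x\<^sup>2 + a\<^sup>2 - 1"
      for x a :: complex
      by (simp add: field_simps)
    have "of_nat n = 2 * e n k + 2 * of_nat k + 1"
      by (simp add: e_def diff_divide_distrib)
    then show ?case
      unfolding sum.lessThan_Suc distrib_left Suc.IH clear
      by (simp add: power2_eq_square algebra_simps)
  qed simp
  from this [of n] show "(\<Sum>m<n. \<Sum>j = 1..n - 1. 1 / (1 - root_unity n ^ j)\<^sup>2 * (1 / root_unity n ^ j) ^ m)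
      = (\<Sum>m<n. (e n m - (e n m)\<^sup>2 + ((of_nat n)\<^sup>2 - 1) / 12) / 2)"
    by (simp only: sum_combination_root_unity_eq_0) simp
qed

section \<open>The rounding error as a trigonometric sum\<close>

text \<open>
  Rounding \<open>y / n\<close> half up takes the floor of \<open>(y + n / 2) / n\<close>. For odd \<open>n\<close> replacing
  \<open>n / 2\<close> by \<open>n div 2\<close> lowers the numerator from a half-integer to the integer just below it,
  which crosses no multiple of \<open>n\<close>; so one formula serves both parities.
\<close>

lemma round_to_multiple_eq:
  assumes "n \<ge> 1"
  shows "round_to_multiple n y = real y + real (n div 2) - real ((y + n div 2) mod n)"
proof -
  define q m where "q = (y + n div 2) div n" and "m = (y + n div 2) mod n"
  have "y + n div 2 = n * q + m"
    by (simp add: q_def m_def)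
  then have split: "real y + real (n div 2) = real n * real q + real m"
    by (metis of_nat_add of_nat_mult)
  have "m + 1 \<le> n"
    using assms by (simp add: m_def Suc_le_eq)
  then have m: "real m + 1 \<le> real n"
    by linarith
  have half: "real (n div 2) \<le> real n / 2" "real n / 2 \<le> real (n div 2) + 1 / 2"
    by linarith+
  have "round (real y / real n) = int q"
    unfolding round_def
  proof (rule floor_unique)
    have "real n * real q \<le> real y + real n / 2" "real y + real n / 2 < real n * (real q + 1)"
      using split m half by (simp_all add: distrib_left)
    then show "of_int (int q) \<le> real y / real n + 1 / 2"
        "real y / real n + 1 / 2 < of_int (int q) + 1"
      using assms by (simp_all add: field_simps)
  qed
  then show ?thesis
    using split by (simp add: round_to_multiple_def m_def)
qed

text \<open>
  The coefficient \<open>a(j)\<close> is the phase produced by the shift \<open>n div 2\<close>: the \<open>n\<close>-th power of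
  \<open>\<omega>\<^sup>j\<^sup>/\<^sup>2\<close> is \<open>(-1)\<^sup>j\<close>, and for odd \<open>n\<close> the integer shift falls one factor \<open>\<omega>\<^sup>j\<^sup>/\<^sup>2\<close> short of it.
\<close>

lemma a_coeff_eq:
  assumes "n \<ge> 1"
  shows "a_coeff n j = (1 / root_unity n ^ j) ^ (n div 2)"
proof -
  let ?z = "half_root_power n j"
  have z: "?z \<noteq> 0"
    by (simp add: half_root_power_def)
  have "?z ^ n = exp (of_nat j * (of_real pi * \<i>))"
    using assms by (simp add: half_root_power_def exp_of_nat_mult [symmetric] mult_ac)
  then have full: "?z ^ n = (- 1) ^ j"
    by (simp only: exp_of_nat_mult exp_pi_i)
  have sign: "(- 1) ^ j * (- 1) ^ j = (1 :: complex)"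
    by (simp add: power_mult_distrib [symmetric])
  have eq: "(1 / root_unity n ^ j) ^ (n div 2) = 1 / ?z ^ (2 * (n div 2))"
    by (simp add: half_root_power_square [symmetric] power_divide power_mult)
  show ?thesis
  proof (cases "even n")
    case True
    then have "(1 / root_unity n ^ j) ^ (n div 2) = 1 / (- 1) ^ j"
      using eq full by simp
    also have "\<dots> = (- 1) ^ j"
      using sign by (simp add: field_simps)
    finally show ?thesis
      using True by (simp add: a_coeff_def)
  next
    case False
    then have "?z ^ (2 * (n div 2)) * ?z = (- 1) ^ j"
      using full by (metis odd_two_times_div_two_succ power_add power_one_right)
    then have "(- 1) ^ j * ?z * ?z ^ (2 * (n div 2)) = 1"
      using sign by (metis mult.assoc mult.commute)
    then show ?thesis
      using False z eq by (simp add: a_coeff_def field_simps)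
  qed
qed

text \<open>
  The real sawtooth \<open>e\<close> is introduced through its Fourier expansion because expectations are taken
  term by term there; its closed form is needed only to identify it and its square.
\<close>

definition sawtooth :: "nat \<Rightarrow> nat \<Rightarrow> complex" where
  "sawtooth n y = (\<Sum>j = 1..n - 1. a_coeff n j / (1 - root_unity n ^ j) * (1 / root_unity n ^ j) ^ y)"

lemma a_coeff_times_character:
  assumes "n \<ge> 1"
  shows "a_coeff n j / d * (1 / root_unity n ^ j) ^ y
    = 1 / d * (1 / root_unity n ^ j) ^ ((y + n div 2) mod n)"
  unfolding inverse_root_unity_power_mod[OF assms] a_coeff_eq[OF assms] power_add
  by (simp only: times_divide_eq_left times_divide_eq_right mult_1 mult.commute)

lemma sawtooth_eq:
  assumes "n \<ge> 1"
  shows "sawtooth n y = (of_nat n - 1) / 2 - of_nat ((y + n div 2) mod n)"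
  unfolding sawtooth_def a_coeff_times_character[OF assms]
  by (rule sum_root_unity_linear) (use assms in simp)

lemma round_to_multiple_sawtooth:
  assumes "n \<ge> 1"
  shows "complex_of_real (round_to_multiple n y)
    = of_nat y + of_real (1 / 2 * (2 * r_const n - 1)) + sawtooth n y"
proof -
  have "real (n div 2) = 1 / 2 * (2 * r_const n - 1) + (real n - 1) / 2"
  proof (cases "even n")
    case True
    then have "2 * real (n div 2) = real n"
      by (metis dvd_mult_div_cancel of_nat_mult of_nat_numeral)
    with True show ?thesis
      by (simp add: r_const_def field_simps)
  next
    case False
    then have "2 * real (n div 2) + 1 = real n"
      by (metis odd_two_times_div_two_succ of_nat_add of_nat_mult of_nat_numeral of_nat_1)
    with False show ?thesis
      by (simp add: r_const_def field_simps)
  qed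
  then have "complex_of_real (real (n div 2))
      = of_real (1 / 2 * (2 * r_const n - 1)) + (of_nat n - 1) / 2"
    by simp
  then show ?thesis
    unfolding round_to_multiple_eq[OF assms] sawtooth_eq[OF assms] of_real_add of_real_diff
    by (simp only: of_real_of_nat_eq) simp
qed

lemma sawtooth_square:
  assumes "n \<ge> 1"
  shows "(sawtooth n y)\<^sup>2 = sawtooth n y + ((of_nat n)\<^sup>2 - 1) / 12
    - 2 * (\<Sum>j = 1..n - 1. a_coeff n j / (1 - root_unity n ^ j)\<^sup>2 * (1 / root_unity n ^ j) ^ y)"
proof -
  have "(y + n div 2) mod n < n"
    using assms by simp
  then have "2 * (\<Sum>j = 1..n - 1.
        a_coeff n j / (1 - root_unity n ^ j)\<^sup>2 * (1 / root_unity n ^ j) ^ y)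
      = sawtooth n y - (sawtooth n y)\<^sup>2 + ((of_nat n)\<^sup>2 - 1) / 12"
    unfolding a_coeff_times_character[OF assms] sawtooth_eq[OF assms]
    by (simp only: sum_root_unity_quadratic times_divide_eq_right)
      (rule nonzero_mult_div_cancel_left, simp)
  then show ?thesis
    by simp
qed

section \<open>Expectations\<close>

context prob_space
begin

lemma has_bochner_integral_pgf:
  assumes "Y \<in> measurable M (count_space UNIV)" "norm s \<le> 1"
  shows "has_bochner_integral M (\<lambda>x. s ^ Y x) (pgf M Y s)"
  using integrable_power_nat_valued[OF assms] pgf_eq_expectation[OF assms]
  by (simp add: has_bochner_integral_iff)

text \<open>
  The series of the expectation has no term at \<open>0\<close>, so it starts at \<open>Suc y\<close>, and one factor \<open>s\<close>
  separates it from the differentiated series. A finite mean makes this valid on the unit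
  circle too, where the generating function need not be differentiable.
\<close>

lemma has_bochner_integral_pgf_deriv:
  assumes Y: "Y \<in> measurable M (count_space UNIV)"
    and int: "integrable M (\<lambda>x. real (Y x))" and s: "norm s \<le> 1"
  shows "has_bochner_integral M (\<lambda>x. of_nat (Y x) * s ^ Y x) (s * pgf_deriv M Y s)"
proof -
  let ?f = "\<lambda>y. of_nat y * s ^ y"
  let ?p = "\<lambda>y. complex_of_real (prob {x \<in> space M. Y x = y})"
  have integrable: "integrable M (\<lambda>x. ?f (Y x))"
  proof (rule Bochner_Integration.integrable_bound[OF int])
    show "(\<lambda>x. ?f (Y x)) \<in> borel_measurable M"
      using measurable_compose[OF Y, of ?f] by simp
    show "AE x in M. norm (?f (Y x)) \<le> norm (real (Y x))"
      using s by (simp add: norm_mult norm_power power_le_one mult_left_le)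
  qed
  have "(\<lambda>y. ?p (Suc y) * ?f (Suc y)) sums (expectation (\<lambda>x. ?f (Y x)))"
    using sums_expectation_nat_valued(2)[OF Y integrable] by (subst sums_Suc_iff) simp
  moreover have "(\<lambda>y. ?p (Suc y) * ?f (Suc y)) sums (s * pgf_deriv M Y s)"
    using sums_mult[OF summable_sums[OF summable_pgf_deriv[OF Y int s]], of s]
    by (simp add: pgf_deriv_def mult_ac del: of_nat_Suc)
  ultimately have "expectation (\<lambda>x. ?f (Y x)) = s * pgf_deriv M Y s"
    by (rule sums_unique2)
  then show ?thesis
    using integrable by (simp add: has_bochner_integral_iff)
qed

end

theorem theorem2:
  fixes M :: "'a measure" and Y :: "'a \<Rightarrow> nat" and n :: nat
    and U :: "'a \<Rightarrow> real" and \<omega> S :: complex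
  assumes M: "prob_space M"
    and Y: "Y \<in> measurable M (count_space UNIV)"
    and n: "n \<ge> 1"
  defines "U \<equiv> \<lambda>x. round_to_multiple n (Y x)"
    and "\<omega> \<equiv> root_unity n"
    and "S \<equiv> (\<Sum>j = 1..n - 1. a_coeff n j * (pgf M Y (1 / \<omega> ^ j) / (1 - \<omega> ^ j)))"
  shows "(integrable M (\<lambda>x. real (Y x)) \<longrightarrow>
      complex_of_real (prob_space.expectation M U) =
        of_real (prob_space.expectation M (\<lambda>x. real (Y x)))
        + of_real (1 / 2 * (2 * r_const n - 1)) + S)
    \<and> (integrable M (\<lambda>x. (real (Y x))\<^sup>2) \<longrightarrow>
      complex_of_real (prob_space.variance M U) =
        of_real (prob_space.variance M (\<lambda>x. real (Y x)))
        + of_real (1 / 12 * ((real n)\<^sup>2 - 1))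
        - of_real (2 * prob_space.expectation M (\<lambda>x. real (Y x)) - 1) * S
        - S\<^sup>2
        + 2 * (\<Sum>j = 1..n - 1. a_coeff n j *
            (pgf_deriv M Y (1 / \<omega> ^ j) / (\<omega> ^ j * (1 - \<omega> ^ j))
             - pgf M Y (1 / \<omega> ^ j) / (1 - \<omega> ^ j)\<^sup>2)))"
proof -
  interpret prob_space M by (rule M)
  \<comment> \<open>\<open>Q\<close> is the expectation of the quadratic periodic term, \<open>T\<close> that of \<open>Y\<close> times the sawtooth.\<close>
  define c where "c = complex_of_real (1 / 2 * (2 * r_const n - 1))"
  define Q where "Q = (\<Sum>j = 1..n - 1. a_coeff n j / (1 - \<omega> ^ j)\<^sup>2 * pgf M Y (1 / \<omega> ^ j))"
  define T where "T = (\<Sum>j = 1..n - 1.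
    a_coeff n j / (1 - \<omega> ^ j) * (1 / \<omega> ^ j * pgf_deriv M Y (1 / \<omega> ^ j)))"
  define \<mu> where "\<mu> = expectation (\<lambda>x. real (Y x))"
  have s: "norm (1 / \<omega> ^ j) \<le> 1" for j
    unfolding \<omega>_def by (simp only: norm_inverse_root_unity_power order_refl)
  have S: "has_bochner_integral M (\<lambda>x. sawtooth n (Y x)) S"
  proof -
    have "S = (\<Sum>j = 1..n - 1. a_coeff n j / (1 - \<omega> ^ j) * pgf M Y (1 / \<omega> ^ j))"
      by (simp add: S_def)
    then show ?thesis
      unfolding sawtooth_def \<omega>_def [symmetric]
      by (auto simp only: intro!: has_bochner_integral_sum has_bochner_integral_mult_right
          has_bochner_integral_pgf[OF Y s])
  qed
  have U: "complex_of_real (U x) = of_nat (Y x) + c + sawtooth n (Y x)" for x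
    unfolding U_def c_def by (rule round_to_multiple_sawtooth[OF n])
  have const: "has_bochner_integral M (\<lambda>x. k) k" for k :: complex
    by (simp add: has_bochner_integral_iff prob_space)
  have mean: "has_bochner_integral M (\<lambda>x. complex_of_nat (Y x)) (of_real \<mu>)"
    if "integrable M (\<lambda>x. real (Y x))"
    using has_bochner_integral_of_real[OF has_bochner_integral_integrable[OF that], where 'a = complex]
    by (simp add: \<mu>_def)
  have EU: "complex_of_real (expectation U) = of_real \<mu> + c + S"
    if int: "integrable M (\<lambda>x. real (Y x))"
  proof -
    have "has_bochner_integral M (\<lambda>x. complex_of_real (U x)) (of_real \<mu> + c + S)"
      unfolding U by (intro has_bochner_integral_add mean[OF int] const S)
    then show ?thesis
      by (simp add: has_bochner_integral_iff)
  qed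
  have VarU: "complex_of_real (variance U) = of_real (variance (\<lambda>x. real (Y x)))
      + of_real (1 / 12 * ((real n)\<^sup>2 - 1)) - of_real (2 * \<mu> - 1) * S - S\<^sup>2 + 2 * (T - Q)"
    if int2: "integrable M (\<lambda>x. (real (Y x))\<^sup>2)"
  proof -
    have int: "integrable M (\<lambda>x. real (Y x))"
      by (rule square_integrable_imp_integrable[OF _ int2])
        (use measurable_compose[OF Y, of real] in simp)
    define \<mu>\<^sub>2 where "\<mu>\<^sub>2 = expectation (\<lambda>x. (real (Y x))\<^sup>2)"
    define K where "K = ((of_nat n)\<^sup>2 - 1) / (12 :: complex)"
    define q where "q = (\<lambda>y. \<Sum>j = 1..n - 1. a_coeff n j / (1 - \<omega> ^ j)\<^sup>2 * (1 / \<omega> ^ j) ^ y)"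
    have second: "has_bochner_integral M (\<lambda>x. (complex_of_nat (Y x))\<^sup>2) (of_real \<mu>\<^sub>2)"
      using has_bochner_integral_of_real[OF has_bochner_integral_integrable[OF int2],
          where 'a = complex]
      by (simp add: \<mu>\<^sub>2_def)
    have Q: "has_bochner_integral M (\<lambda>x. q (Y x)) Q"
      unfolding Q_def q_def
      by (intro has_bochner_integral_sum has_bochner_integral_mult_right
          has_bochner_integral_pgf[OF Y s])
    have "has_bochner_integral M (\<lambda>x. \<Sum>j = 1..n - 1.
        a_coeff n j / (1 - \<omega> ^ j) * (of_nat (Y x) * (1 / \<omega> ^ j) ^ Y x)) T"
      unfolding T_def
      by (intro has_bochner_integral_sum has_bochner_integral_mult_right
          has_bochner_integral_pgf_deriv[OF Y int s])
    then have T: "has_bochner_integral M (\<lambda>x. of_nat (Y x) * sawtooth n (Y x)) T"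
      unfolding sawtooth_def \<omega>_def [symmetric] sum_distrib_left
      by (simp only: mult.left_commute)
    \<comment> \<open>Every term on the right is linear in quantities whose expectations are known: \<open>e\<^sup>2\<close> is gone.\<close>
    have U2: "complex_of_real ((U x)\<^sup>2) = (of_nat (Y x))\<^sup>2 + 2 * c * of_nat (Y x)
        + 2 * (of_nat (Y x) * sawtooth n (Y x)) + (2 * c + 1) * sawtooth n (Y x)
        + (c\<^sup>2 + K) - 2 * q (Y x)" for x
    proof -
      have "complex_of_real ((U x)\<^sup>2) = (of_nat (Y x))\<^sup>2 + 2 * c * of_nat (Y x)
          + 2 * (of_nat (Y x) * sawtooth n (Y x)) + 2 * c * sawtooth n (Y x)
          + c\<^sup>2 + (sawtooth n (Y x))\<^sup>2"
        unfolding of_real_power U by (simp add: power2_eq_square algebra_simps)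
      moreover have "(sawtooth n (Y x))\<^sup>2 = sawtooth n (Y x) + K - 2 * q (Y x)"
        unfolding q_def K_def \<omega>_def by (rule sawtooth_square[OF n])
      ultimately show ?thesis
        by (simp add: algebra_simps)
    qed
    have "has_bochner_integral M (\<lambda>x. complex_of_real ((U x)\<^sup>2))
        (of_real \<mu>\<^sub>2 + 2 * c * of_real \<mu> + 2 * T + (2 * c + 1) * S + (c\<^sup>2 + K) - 2 * Q)"
      unfolding U2
      by (intro has_bochner_integral_add has_bochner_integral_diff has_bochner_integral_mult_right
          second mean[OF int] T S const Q)
    then have EU2: "complex_of_real (expectation (\<lambda>x. (U x)\<^sup>2))
        = of_real \<mu>\<^sub>2 + 2 * c * of_real \<mu> + 2 * T + (2 * c + 1) * S + (c\<^sup>2 + K) - 2 * Q"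
      by (simp only: has_bochner_integral_iff integral_complex_of_real)
    have "variance U = expectation (\<lambda>x. (U x)\<^sup>2) - (expectation U)\<^sup>2"
      unfolding U_def using integrable_round_to_multiple[OF Y n] int int2 by (intro variance_eq)
    then have VU: "complex_of_real (variance U)
        = of_real (expectation (\<lambda>x. (U x)\<^sup>2)) - (of_real (expectation U))\<^sup>2"
      by simp
    have VY: "variance (\<lambda>x. real (Y x)) = \<mu>\<^sub>2 - \<mu>\<^sup>2"
      unfolding \<mu>_def \<mu>\<^sub>2_def using int int2 by (rule variance_eq)
    have K: "complex_of_real (1 / 12 * ((real n)\<^sup>2 - 1)) = K"
      by (simp add: K_def)
    show ?thesis
      unfolding VU VY K EU2 EU[OF int] by (simp add: power2_eq_square algebra_simps)
  qed
  have "T - Q = (\<Sum>j = 1..n - 1. a_coeff n j *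
      (pgf_deriv M Y (1 / \<omega> ^ j) / (\<omega> ^ j * (1 - \<omega> ^ j))
       - pgf M Y (1 / \<omega> ^ j) / (1 - \<omega> ^ j)\<^sup>2))"
    unfolding T_def Q_def sum_subtractf [symmetric]
    by (simp add: right_diff_distrib mult.commute)
  with EU VarU show ?thesis
    unfolding c_def \<mu>_def by simp
qed

end
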